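(* For every adaptive priority algorithm $A$ in the vertex model (greedy or not) there exists a graph $G$ with maximum degree at most $3$ such that the matching computed by $A$ on $G$ has size at most $\frac23\,\nu(G)$. Hence no adaptive priority algorithm achieves an approximation ratio better than $\frac23$, even on graphs of maximum degree $3$; consequently the deterministic min-degree greedy algorithm (an adaptive priority algorithm that returns a matching of size at least $\frac23\nu(G)$ on every graph of maximum degree at most $3$) is an optimal adaptive priority algorithm for these graphs.
   Context: $\nu(G)$ is the size of a maximum matching of a finite simple graph $G$. Vertex model: for a node $u$ with neighbors $v_1,\dots,v_d$ in the input graph, the data item of $u$ is $\langle u;v_1,\dots,v_d\rangle$; node identifiers come from a fixed universe. An adaptive priority algorithm proceeds in rounds; in each round it deterministically chooses, as a function only of the data items received so far and its own decisions (without otherwise looking at the input), a total order $\pi$ on the set of all possible data items, and receives the first data item (w.r.t. $\pi$) of the input whose node $u$ is still matchable, i.e., neither matched nor isolated; it then irrevocably either matches $u$ to a matchable neighbor or isolates $u$ (which can then never be matched). This repeats until no matchable node with a matchable neighbor remains. A greedy adaptive priority algorithm may not isolate $u$. The deterministic min-degree greedy algorithm repeatedly picks an arbitrary non-isolated node of minimum current degree and matches it to an arbitrary current neighbor, deleting both. *)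

theory Defs
  imports Complex_Main "HOL-Library.While_Combinator"
begin

record 'a graph =
  verts :: "'a set"
  edges :: "'a set set"

definition simple_graph :: "'a graph \<Rightarrow> bool" where
  "simple_graph G \<longleftrightarrow> finite (verts G) \<and>
     edges G \<subseteq> {{u, v} |u v. u \<in> verts G \<and> v \<in> verts G \<and> u \<noteq> v}"

definition neighbors :: "'a graph \<Rightarrow> 'a \<Rightarrow> 'a set" where
  "neighbors G u = {v. {u, v} \<in> edges G}"

definition degree :: "'a graph \<Rightarrow> 'a \<Rightarrow> nat" where
  "degree G u = card (neighbors G u)"

definition delete_verts :: "'a graph \<Rightarrow> 'a set \<Rightarrow> 'a graph" where
  "delete_verts G S = \<lparr>verts = verts G - S, edges = {e \<in> edges G. e \<inter> S = {}}\<rparr>"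

definition bounded_degree_graph :: "nat \<Rightarrow> 'a graph \<Rightarrow> bool" where
  "bounded_degree_graph d G \<longleftrightarrow> simple_graph G \<and> (\<forall>u \<in> verts G. degree G u \<le> d)"

definition matching :: "'a graph \<Rightarrow> 'a set set \<Rightarrow> bool" where
  "matching G M \<longleftrightarrow> M \<subseteq> edges G \<and> pairwise disjnt M"

definition matching_number :: "'a graph \<Rightarrow> nat" where
  "matching_number G = Max {card M |M. matching G M}"

definition edge_set :: "('a \<times> 'a) list \<Rightarrow> 'a set set" where
  "edge_set es = (\<lambda>(u, v). {u, v}) ` set es"

text \<open>The universe of node identifiers is the type \<open>'a\<close>. A data item consists of a node
  and the set of its neighbors in the input graph.\<close>

type_synonym 'a item = "'a \<times> 'a set"

definition possible_items :: "'a item set" where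
  "possible_items = {(u, N). finite N \<and> u \<notin> N}"

definition data_item :: "'a graph \<Rightarrow> 'a \<Rightarrow> 'a item" where
  "data_item G u = (u, neighbors G u)"

datatype 'a decision = Match 'a | Isolate

text \<open>The items received so far with the decisions taken on them, in chronological order.\<close>

type_synonym 'a history = "('a item \<times> 'a decision) list"

text \<open>In \<open>priority A h\<close>, the pair \<open>(x, y)\<close> means that \<open>x\<close> comes before
  (or equals) \<open>y\<close>. As \<open>priority\<close> and \<open>decide\<close> are functions of the history (and of the item
  just received), an algorithm has no other access to the input.\<close>

record 'a priority_algorithm =
  priority :: "'a history \<Rightarrow> 'a item rel"
  decide :: "'a history \<Rightarrow> 'a item \<Rightarrow> 'a decision"

fun matched_pairs :: "'a history \<Rightarrow> ('a \<times> 'a) list" where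
  "matched_pairs [] = []"
| "matched_pairs (((u, N), Match v) # h) = (u, v) # matched_pairs h"
| "matched_pairs (((u, N), Isolate) # h) = matched_pairs h"

definition matched_nodes :: "'a history \<Rightarrow> 'a set" where
  "matched_nodes h = \<Union> (edge_set (matched_pairs h))"

definition isolated_nodes :: "'a history \<Rightarrow> 'a set" where
  "isolated_nodes h = {u. \<exists>N. ((u, N), Isolate) \<in> set h}"

definition unmatchable :: "'a history \<Rightarrow> 'a set" where
  "unmatchable h = matched_nodes h \<union> isolated_nodes h"

definition adaptive_priority_algorithm :: "'a priority_algorithm \<Rightarrow> bool" where
  "adaptive_priority_algorithm A \<longleftrightarrow>
     (\<forall>h. linear_order_on possible_items (priority A h)) \<and>
     (\<forall>h u N v. (u, N) \<in> possible_items \<longrightarrow> decide A h (u, N) = Match v \<longrightarrow> v \<in> N - unmatchable h)"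

text \<open>An item may be received although its node has no matchable neighbor left; then isolating
  the node is the only possible decision, also for a greedy algorithm.\<close>

definition greedy :: "'a priority_algorithm \<Rightarrow> bool" where
  "greedy A \<longleftrightarrow>
     (\<forall>h u N. (u, N) \<in> possible_items \<longrightarrow> N - unmatchable h \<noteq> {} \<longrightarrow> decide A h (u, N) \<noteq> Isolate)"

definition matchable :: "'a graph \<Rightarrow> 'a history \<Rightarrow> 'a set" where
  "matchable G h = verts G - unmatchable h"

definition finished :: "'a graph \<Rightarrow> 'a history \<Rightarrow> bool" where
  "finished G h \<longleftrightarrow> \<not> (\<exists>u \<in> matchable G h. \<exists>v \<in> matchable G h. v \<in> neighbors G u)"

definition next_item :: "'a priority_algorithm \<Rightarrow> 'a graph \<Rightarrow> 'a history \<Rightarrow> 'a item" where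
  "next_item A G h = (THE x. x \<in> data_item G ` matchable G h \<and>
     (\<forall>y \<in> data_item G ` matchable G h. (x, y) \<in> priority A h))"

definition next_history :: "'a priority_algorithm \<Rightarrow> 'a graph \<Rightarrow> 'a history \<Rightarrow> 'a history" where
  "next_history A G h = (let x = next_item A G h in h @ [(x, decide A h x)])"

text \<open>For finite inputs the loop terminates, since every round makes the node of the received
  item unmatchable.\<close>

definition run :: "'a priority_algorithm \<Rightarrow> 'a graph \<Rightarrow> 'a history" where
  "run A G = while (\<lambda>h. \<not> finished G h) (next_history A G) []"

definition computed_matching :: "'a priority_algorithm \<Rightarrow> 'a graph \<Rightarrow> 'a set set" where
  "computed_matching A G = edge_set (matched_pairs (run A G))"

definition achieves_ratio :: "nat \<Rightarrow> 'a priority_algorithm \<Rightarrow> real \<Rightarrow> bool" where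
  "achieves_ratio d A \<rho> \<longleftrightarrow>
     (\<forall>G. bounded_degree_graph d G \<longrightarrow>
        \<rho> * real (matching_number G) \<le> real (card (computed_matching A G)))"

definition optimal_priority_algorithm :: "nat \<Rightarrow> 'a priority_algorithm \<Rightarrow> bool" where
  "optimal_priority_algorithm d A \<longleftrightarrow> adaptive_priority_algorithm A \<and>
     (\<forall>(B :: 'a priority_algorithm) \<rho>. adaptive_priority_algorithm B \<and> achieves_ratio d B \<rho> \<longrightarrow> achieves_ratio d A \<rho>)"

text \<open>\<open>min_degree_greedy G es\<close>: for some way of making the arbitrary choices, min-degree greedy
  on input \<open>G\<close> successively selects the pairs in \<open>es\<close>, where each pair consists of the picked
  node and the neighbor it is matched to.\<close>

inductive min_degree_greedy :: "'a graph \<Rightarrow> ('a \<times> 'a) list \<Rightarrow> bool" where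
  stop: "edges G = {} \<Longrightarrow> min_degree_greedy G []"
| pick: "\<lbrakk>u \<in> verts G; neighbors G u \<noteq> {};
    \<forall>w \<in> verts G. neighbors G w \<noteq> {} \<longrightarrow> degree G u \<le> degree G w;
    v \<in> neighbors G u;
    min_degree_greedy (delete_verts G {u, v}) es\<rbrakk>
   \<Longrightarrow> min_degree_greedy G ((u, v) # es)"

definition implements_min_degree_greedy :: "'a priority_algorithm \<Rightarrow> bool" where
  "implements_min_degree_greedy A \<longleftrightarrow>
     (\<forall>G :: 'a graph. simple_graph G \<longrightarrow> min_degree_greedy G (matched_pairs (run A G)))"

end

theory Submission
  imports Defs "HOL-Library.Extended_Nat"
begin

text \<open>The guarantee of min-degree greedy: if no node has degree 1, it suffices that the number of
  picked pairs is at least a third of the number of non-isolated nodes, as \<open>\<nu>(G)\<close> is at most half of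
  the latter. This follows from the invariant \<open>\<Sum>\<^sub>w min (deg w) 2 \<le> 6 |es|\<close>, which holds for
  every input of maximum degree 3: a pick decreases the left-hand side by at most 6, or possibly 7
  if the minimum degree is 2; but in that case the sum is even before the pick and odd after it.
  Picks of nodes of degree 1 decrease \<open>\<nu>\<close> by at most 1, so an initial phase of such picks is harmless.

  The limit of priority algorithms: in two triangles joined by an edge \<open>cd\<close>, the only perfect matching contains \<open>cd\<close>. Among
  all items of degree 2 or 3 over six nodes, let \<open>A\<close> receive its first one, with node \<open>u\<close>.
  Whether \<open>u\<close> has degree 2 or 3, the six nodes can be arranged in such a graph so that the first
  decision of \<open>A\<close> either isolates \<open>u\<close> or matches an end of the bridge inside its triangle.\<close>

section \<open>Finite simple graphs, deletion of nodes and matchings\<close>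

lemma neighbors_commute: "v \<in> neighbors G u \<longleftrightarrow> u \<in> neighbors G v"
  by (simp add: neighbors_def insert_commute)

lemma neighbors_subset: "simple_graph G \<Longrightarrow> neighbors G u \<subseteq> verts G - {u}"
  by (fastforce simp: simple_graph_def neighbors_def doubleton_eq_iff)

lemma neighbors_in_verts: "simple_graph G \<Longrightarrow> v \<in> neighbors G u \<Longrightarrow> u \<in> verts G \<and> v \<in> verts G \<and> u \<noteq> v"
  using neighbors_subset[of G u] neighbors_subset[of G v] neighbors_commute[of v G u] by auto

lemma finite_neighbors: "simple_graph G \<Longrightarrow> finite (neighbors G u)"
  by (meson finite_Diff finite_subset neighbors_subset simple_graph_def)

lemma edgeE:
  assumes "simple_graph G" "e \<in> edges G"
  obtains x y where "e = {x, y}" "y \<in> neighbors G x"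
  using assms by (auto simp: simple_graph_def neighbors_def)

lemma finite_edges: "simple_graph G \<Longrightarrow> finite (edges G)"
proof -
  assume G: "simple_graph G"
  then have "edges G \<subseteq> Pow (verts G)" by (auto simp: simple_graph_def)
  with G show ?thesis by (meson finite_Pow_iff finite_subset simple_graph_def)
qed

lemma neighbors_delete_verts:
  "neighbors (delete_verts G S) w = (if w \<in> S then {} else neighbors G w - S)"
  by (auto simp: neighbors_def delete_verts_def)

lemma simple_graph_delete_verts: "simple_graph G \<Longrightarrow> simple_graph (delete_verts G S)"
  unfolding simple_graph_def delete_verts_def by (simp, blast)

lemma delete_verts_empty: "delete_verts G {} = G"
  by (simp add: delete_verts_def)

lemma delete_verts_Un: "delete_verts (delete_verts G S) T = delete_verts G (S \<union> T)"
  by (auto simp: delete_verts_def)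

lemma bounded_degree_graph_delete_verts:
  assumes "bounded_degree_graph d G"
  shows "bounded_degree_graph d (delete_verts G S)"
proof -
  have "degree (delete_verts G S) w \<le> degree G w" for w
    using assms unfolding degree_def neighbors_delete_verts bounded_degree_graph_def
    by (auto intro!: card_mono finite_neighbors)
  with assms show ?thesis
    by (auto simp: bounded_degree_graph_def simple_graph_delete_verts)
      (force simp: delete_verts_def intro: order_trans)
qed

lemma finite_matching_cards: "simple_graph G \<Longrightarrow> finite {card M |M. matching G M}"
proof -
  assume "simple_graph G"
  then have "finite (Pow (edges G))" by (simp add: finite_edges)
  moreover have "{card M |M. matching G M} \<subseteq> card ` Pow (edges G)"
    by (auto simp: matching_def)
  ultimately show ?thesis by (meson finite_imageI finite_subset)
qed

lemma matching_number_ge: "simple_graph G \<Longrightarrow> matching G M \<Longrightarrow> card M \<le> matching_number G"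
  unfolding matching_number_def by (auto intro!: Max_ge finite_matching_cards)

lemma matching_number_attained:
  assumes "simple_graph G"
  obtains M where "matching G M" "card M = matching_number G"
proof -
  have "matching G {}" by (simp add: matching_def)
  then have "matching_number G \<in> {card M |M. matching G M}"
    unfolding matching_number_def by (intro Max_in finite_matching_cards assms) auto
  then show ?thesis using that by auto
qed

lemma card_Union_matching:
  assumes "simple_graph G" "matching G M"
  shows "card (\<Union> M) = 2 * card M"
proof -
  have e: "finite e \<and> card e = 2" if "e \<in> M" for e
  proof -
    have "e \<in> edges G" using that assms by (auto simp: matching_def)
    then show ?thesis
      using edgeE[OF assms(1)] neighbors_in_verts[OF assms(1)] by (metis card_2_iff card.infinite zero_neq_numeral)
  qed
  have "card (\<Union> M) = (\<Sum>e\<in>M. card e)"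
    using assms e by (intro card_Union_disjoint) (auto simp: matching_def)
  also have "\<dots> = 2 * card M" using e by simp
  finally show ?thesis .
qed

section \<open>Guarantee of min-degree greedy on graphs of maximum degree 3\<close>

text \<open>The picked nodes account for at most 4 of the decrease, and each of the
  \<open>degree G u + degree G v - 2\<close> edge ends at other nodes lowers a capped degree by at
  most 1. This gives at most 5 if \<open>u\<close> is a leaf, but up to 7 or 8 otherwise; degree 2
  is rescued by parity, degree 3 by the cap.\<close>

lemma capped_degree_sum_delete_edge:
  assumes bd: "bounded_degree_graph 3 G"
    and u: "u \<in> verts G" "neighbors G u \<noteq> {}"
    and least: "\<forall>w \<in> verts G. neighbors G w \<noteq> {} \<longrightarrow> degree G u \<le> degree G w"
    and v: "v \<in> neighbors G u"
    and rest: "(\<Sum>w\<in>verts (delete_verts G {u, v}). min (degree (delete_verts G {u, v}) w) 2) \<le> 6 * k"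
  shows "(\<Sum>w\<in>verts G. min (degree G w) 2) \<le> 6 * Suc k"
proof -
  define H where "H = delete_verts G {u, v}"
  define V where "V = verts G - {u, v}"
  \<comment> \<open>\<open>e x\<close> counts the edges from \<open>x\<close> to the picked pair,
    which is what the degree of \<open>x\<close> loses.\<close>
  define e where "e x = (if x \<in> neighbors G u then 1 else 0) + (if x \<in> neighbors G v then 1 else 0 :: nat)" for x
  have G: "simple_graph G" and fin: "finite V" "finite (verts G)"
    using bd by (auto simp: bounded_degree_graph_def simple_graph_def V_def)
  note fN = finite_neighbors[OF G]
  have uv: "u \<in> verts G" "v \<in> verts G" "u \<noteq> v" "u \<in> neighbors G v"
    using neighbors_in_verts[OF G v] v neighbors_commute[of v G u] by auto
  have VH: "verts H = V" by (simp add: H_def V_def delete_verts_def)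
  have deg_e: "degree G x = degree H x + e x" if "x \<in> V" for x
  proof -
    have "degree G x = card (neighbors G x - {u, v}) + card (neighbors G x \<inter> {u, v})"
      unfolding degree_def by (subst card_Un_disjoint[symmetric]) (auto simp: fN intro!: arg_cong[where f=card])
    moreover have "card (neighbors G x \<inter> {u, v}) = e x"
      using uv neighbors_commute[of x G u] neighbors_commute[of x G v] by (auto simp: e_def Int_insert_right)
    ultimately show ?thesis using that by (simp add: degree_def H_def neighbors_delete_verts V_def)
  qed
  \<comment> \<open>Double counting from the side of \<open>u\<close> and \<open>v\<close>: each of
    them spends one of its edges on the other, hence the two subtractions of 1.\<close>
  have "(\<Sum>x\<in>V. e x) = card (neighbors G u \<inter> V) + card (neighbors G v \<inter> V)"
    using fin by (simp add: e_def sum.distrib sum.If_cases Int_commute)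
  moreover have "neighbors G u \<inter> V = neighbors G u - {v}" "neighbors G v \<inter> V = neighbors G v - {u}"
    using neighbors_subset[OF G] by (auto simp: V_def)
  ultimately have sum_e: "(\<Sum>x\<in>V. e x) = (degree G u - 1) + (degree G v - 1)"
    using v uv by (simp add: degree_def)
  have pos: "degree G u \<ge> 1" "degree G v \<ge> 1"
    using v uv fN by (auto simp: degree_def Suc_le_eq card_gt_0_iff)
  have le3: "degree G x \<le> 3" if "x \<in> verts G" for x
    using bd that by (simp add: bounded_degree_graph_def)
  have min_deg: "degree G x = 0 \<or> degree G u \<le> degree G x" if "x \<in> verts G" for x
    using least that fN by (auto simp: degree_def)
  have split: "(\<Sum>w\<in>verts G. min (degree G w) 2) =
      min (degree G u) 2 + min (degree G v) 2 + (\<Sum>w\<in>V. min (degree G w) 2)"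
    using uv fin by (simp add: V_def sum.remove[of _ u] sum.remove[of "_ - {u}" v]
        Diff_insert2[of _ u "{v}"])
  have H: "(\<Sum>w\<in>V. min (degree H w) 2) \<le> 6 * k"
    using rest by (simp add: H_def[symmetric] VH)
  \<comment> \<open>Capping is 1-Lipschitz, so a capped degree drops by no more than the degree
    itself.\<close>
  have drop: "(\<Sum>w\<in>V. min (degree G w) 2) \<le> (\<Sum>w\<in>V. min (degree H w) 2) + (\<Sum>x\<in>V. e x)"
    unfolding sum.distrib[symmetric] by (rule sum_mono) (simp add: deg_e)
  consider "degree G u = 1" | "degree G u = 2" | "degree G u = 3"
    using le3[OF uv(1)] pos by linarith
  then show ?thesis
  proof cases
    case 1
    then show ?thesis using split drop sum_e H le3[OF uv(2)] by simp
  next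
    case 2
    \<comment> \<open>The capped degree sum may drop by 7, but it is even as there are no leaves.\<close>
    have "even (min (degree G x) 2)" if "x \<in> verts G" for x
      using min_deg[OF that] 2 by auto
    then have "even (\<Sum>w\<in>verts G. min (degree G w) 2)" by (rule dvd_sum)
    moreover have "(\<Sum>w\<in>verts G. min (degree G w) 2) \<le> 6 * k + 7"
      using 2 split drop sum_e H le3[OF uv(2)] by simp
    ultimately show ?thesis by presburger
  next
    case 3
    \<comment> \<open>All nonzero degrees are 3, so only common neighbours of u and v lose capped degree.\<close>
    have "2 * min (degree G x) 2 \<le> 2 * min (degree H x) 2 + e x" if "x \<in> V" for x
    proof -
      have "x \<in> verts G" using that by (simp add: V_def)
      then have "degree G x = 0 \<or> degree G x = 3" using min_deg[of x] le3[of x] 3 by auto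
      moreover have "e x \<le> 2" by (simp add: e_def)
      ultimately show ?thesis using deg_e[OF that] by (auto simp: min_def)
    qed
    then have "(\<Sum>w\<in>V. 2 * min (degree G w) 2) \<le> (\<Sum>w\<in>V. 2 * min (degree H w) 2 + e w)"
      by (rule sum_mono)
    then have "2 * (\<Sum>w\<in>V. min (degree G w) 2) \<le> 2 * (\<Sum>w\<in>V. min (degree H w) 2) + (\<Sum>x\<in>V. e x)"
      by (simp add: sum.distrib sum_distrib_left)
    \<comment> \<open>The at most four edges to other nodes cost 1/2 each, so the total is at most 4
      + 2.\<close>
    then show ?thesis using 3 split sum_e H le3[OF uv(2)] by simp
  qed
qed

text \<open>Leaves are allowed although the bound is applied to leafless graphs only: deletions can
  create leaves, and the induction passes through those graphs.\<close>

lemma capped_degree_sum_le: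
  assumes "min_degree_greedy G es" "bounded_degree_graph 3 G"
  shows "(\<Sum>w\<in>verts G. min (degree G w) 2) \<le> 6 * length es"
  using assms
proof induction
  case (stop G)
  then show ?case by (simp add: degree_def neighbors_def)
next
  case (pick u G v es)
  then show ?case
    using capped_degree_sum_delete_edge[of G u v "length es"] bounded_degree_graph_delete_verts
    by force
qed

text \<open>Since \<open>v\<close> is the only neighbor of the leaf \<open>u\<close>, every edge
  that meets the pair contains \<open>v\<close>, and a matching has at most one such edge.\<close>

lemma card_matching_le_delete_leaf_edge:
  assumes G: "simple_graph G" and M: "matching G M"
    and v: "v \<in> neighbors G u" and leaf: "degree G u = 1"
  shows "\<exists>M'. matching (delete_verts G {u, v}) M' \<and> card M \<le> Suc (card M')"
proof (intro exI conjI)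
  let ?M' = "{e \<in> M. e \<inter> {u, v} = {}}"
  have finM: "finite M" using M finite_edges[OF G] by (auto simp: matching_def intro: finite_subset)
  show "matching (delete_verts G {u, v}) ?M'"
    using M by (auto simp: matching_def delete_verts_def pairwise_def)
  have Nu: "neighbors G u = {v}" using leaf v by (auto simp: degree_def card_1_singleton_iff)
  have through_v: "v \<in> e" if "e \<in> M - ?M'" for e
  proof -
    have "e \<in> edges G" using that M by (auto simp: matching_def)
    then obtain x y where e: "e = {x, y}" "y \<in> neighbors G x" by (rule edgeE[OF G])
    with that Nu neighbors_commute[of y G x] show ?thesis by auto
  qed
  have "card (M - ?M') \<le> 1"
  proof (subst One_nat_def, subst card_le_Suc0_iff_eq)
    show "finite (M - ?M')" using finM by simp
    show "\<forall>a\<in>M - ?M'. \<forall>b\<in>M - ?M'. a = b"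
      using through_v M by (metis (lifting) DiffD1 matching_def pairwiseD disjnt_iff)
  qed
  moreover have "card M = card ?M' + card (M - ?M')"
    using finM by (subst card_Un_disjoint[symmetric]) (auto intro!: arg_cong[where f=card])
  ultimately show "card M \<le> Suc (card ?M')" by linarith
qed

text \<open>A leaf pick costs the optimum at most one edge, so the induction hypothesis handles it.
  At the first pick of higher degree there are no leaves, and the invariant settles the entire
  remaining run at once: \<open>4 * card M\<close> is at most twice the number of non-isolated
  nodes, hence at most the capped degree sum. Speaking of all matchings instead of \<nu> lets the
  restricted matching be passed directly to the induction hypothesis.\<close>

lemma min_degree_greedy_approx:
  assumes "min_degree_greedy G es" "bounded_degree_graph 3 G" "matching G M"
  shows "2 * card M \<le> 3 * length es"
  using assms
proof (induction arbitrary: M)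
  case (stop G)
  then show ?case by (simp add: matching_def)
next
  case (pick u G v es)
  have G: "simple_graph G" using pick.prems by (simp add: bounded_degree_graph_def)
  then have fin: "finite (verts G)" by (simp add: simple_graph_def)
  show ?case
  proof (cases "degree G u = 1")
    case True
    then obtain M' where "matching (delete_verts G {u, v}) M'" "card M \<le> Suc (card M')"
      using card_matching_le_delete_leaf_edge[OF G] pick.prems pick.hyps by blast
    then show ?thesis
      using pick.IH[of M'] bounded_degree_graph_delete_verts[OF pick.prems(1)] by force
  next
    case False
    \<comment> \<open>Without leaves the capped degree sum is twice the number of non-isolated nodes.\<close>
    have ge2: "degree G w \<ge> 2" if "w \<in> verts G" "neighbors G w \<noteq> {}" for w
    proof -
      have "degree G u \<noteq> 0" using pick.hyps finite_neighbors[OF G] by (simp add: degree_def)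
      with False have "2 \<le> degree G u" by linarith
      with pick.hyps that show ?thesis by force
    qed
    have sub: "\<Union> M \<subseteq> {w \<in> verts G. neighbors G w \<noteq> {}}"
    proof
      fix x assume "x \<in> \<Union> M"
      then obtain e where "x \<in> e" "e \<in> edges G" using pick.prems by (auto simp: matching_def)
      then obtain y z where "x \<in> {y, z}" "z \<in> neighbors G y" using edgeE[OF G] by metis
      then show "x \<in> {w \<in> verts G. neighbors G w \<noteq> {}}"
        using neighbors_in_verts[OF G] neighbors_commute by fastforce
    qed
    have "2 * (2 * card M) = 2 * card (\<Union> M)"
      using card_Union_matching[OF G] pick.prems by simp
    also have "\<dots> \<le> 2 * card {w \<in> verts G. neighbors G w \<noteq> {}}"
      using sub fin by (simp add: card_mono)
    also have "\<dots> = (\<Sum>w\<in>{w \<in> verts G. neighbors G w \<noteq> {}}. 2)" by simp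
    also have "\<dots> \<le> (\<Sum>w\<in>{w \<in> verts G. neighbors G w \<noteq> {}}. min (degree G w) 2)"
      using ge2 by (intro sum_mono) simp
    also have "\<dots> \<le> (\<Sum>w\<in>verts G. min (degree G w) 2)"
      using fin by (intro sum_mono2) auto
    also have "\<dots> \<le> 6 * length ((u, v) # es)"
      by (rule capped_degree_sum_le[OF min_degree_greedy.pick pick.prems(1)]) (use pick.hyps in auto)
    finally show ?thesis by simp
  qed
qed

text \<open>Pairs selected later avoid \<open>u\<close> and \<open>v\<close>, so the picked edge is
  disjoint from theirs and in particular new; hence nothing is lost in passing from the list to the
  set.\<close>

lemma min_degree_greedy_matching:
  assumes "min_degree_greedy G es" "simple_graph G"
  shows "matching G (edge_set es) \<and> card (edge_set es) = length es"
  using assms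
proof induction
  case (stop G)
  then show ?case by (simp add: edge_set_def matching_def)
next
  case (pick u G v es)
  then have IH: "matching (delete_verts G {u, v}) (edge_set es)" "card (edge_set es) = length es"
    using simple_graph_delete_verts by blast+
  have eq: "edge_set ((u, v) # es) = insert {u, v} (edge_set es)" by (simp add: edge_set_def)
  have disj: "e \<in> edges G \<and> e \<inter> {u, v} = {}" if "e \<in> edge_set es" for e
    using IH(1) that by (auto simp: matching_def delete_verts_def)
  have "{u, v} \<notin> edge_set es" using disj by fastforce
  moreover have "finite (edge_set es)" by (simp add: edge_set_def)
  moreover have "{u, v} \<in> edges G" using pick.hyps by (simp add: neighbors_def)
  moreover have "pairwise disjnt (insert {u, v} (edge_set es))"
    using IH(1) disj unfolding pairwise_insert matching_def disjnt_def by blast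
  ultimately show ?case using IH disj unfolding eq matching_def by auto
qed

section \<open>Histories and runs of adaptive priority algorithms\<close>

lemma matched_pairs_append: "matched_pairs (h @ h') = matched_pairs h @ matched_pairs h'"
  by (induction h rule: matched_pairs.induct) auto

lemma unmatchable_Nil: "unmatchable [] = {}"
  by (simp add: unmatchable_def matched_nodes_def isolated_nodes_def edge_set_def)

lemma unmatchable_snoc_Match: "unmatchable (h @ [((u, N), Match v)]) = unmatchable h \<union> {u, v}"
  by (auto simp: unmatchable_def matched_nodes_def isolated_nodes_def edge_set_def matched_pairs_append)

lemma unmatchable_snoc_Isolate: "unmatchable (h @ [((u, N), Isolate)]) = insert u (unmatchable h)"
  by (auto simp: unmatchable_def matched_nodes_def isolated_nodes_def edge_set_def matched_pairs_append)

lemma data_item_possible: "simple_graph G \<Longrightarrow> data_item G u \<in> possible_items"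
  using finite_neighbors[of G u] neighbors_subset[of G u]
  by (auto simp: data_item_def possible_items_def)

text \<open>A linear order need not be well-founded; the finiteness of \<open>X\<close> supplies the
  minimum. This serves both the items available in a round and the adversary's set of candidate
  items.\<close>

lemma linear_order_on_ex1_least:
  assumes r: "linear_order_on A r" and X: "finite X" "X \<noteq> {}" "X \<subseteq> A"
  shows "\<exists>!x. x \<in> X \<and> (\<forall>y\<in>X. (x, y) \<in> r)"
proof -
  have refl: "(x, x) \<in> r" if "x \<in> A" for x
    using r that by (auto simp: order_on_defs refl_on_def)
  have trans: "trans r" and anti: "antisym r" and total: "total_on A r"
    using r by (auto simp: order_on_defs)
  have "\<exists>x\<in>X. \<forall>y\<in>X. (x, y) \<in> r"
    using X
  proof (induction rule: finite_ne_induct)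
    case (singleton x)
    then show ?case using refl by simp
  next
    case (insert z F)
    then obtain x where x: "x \<in> F" "\<forall>y\<in>F. (x, y) \<in> r" by auto
    with insert.prems insert.hyps total have "(x, z) \<in> r \<or> (z, x) \<in> r"
      unfolding total_on_def by (metis insert_subset subset_iff)
    then show ?case
    proof
      assume "(x, z) \<in> r"
      with x show ?thesis by blast
    next
      assume "(z, x) \<in> r"
      with x trans have "\<forall>y\<in>F. (z, y) \<in> r" by (meson transE)
      with refl insert.prems show ?thesis by auto
    qed
  qed
  with anti show ?thesis by (auto dest: antisymD)
qed

lemma next_item_eqI:
  assumes "adaptive_priority_algorithm A" "simple_graph G"
    and "x \<in> data_item G ` matchable G h"
    and "\<forall>y \<in> data_item G ` matchable G h. (x, y) \<in> priority A h"
  shows "next_item A G h = x"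
proof -
  have "antisym (priority A h)"
    using assms(1) by (simp add: adaptive_priority_algorithm_def order_on_defs)
  with assms(3,4) show ?thesis
    unfolding next_item_def by (intro the_equality) (auto dest: antisymD)
qed

text \<open>The items of matchable nodes form a finite nonempty set, so the definite description in
  \<open>next_item\<close> denotes their actual minimum.\<close>

lemma next_item_least:
  assumes A: "adaptive_priority_algorithm A" and G: "simple_graph G" and ne: "matchable G h \<noteq> {}"
  shows "next_item A G h \<in> data_item G ` matchable G h"
    and "\<forall>y \<in> data_item G ` matchable G h. (next_item A G h, y) \<in> priority A h"
proof -
  have "\<exists>!x. x \<in> data_item G ` matchable G h \<and> (\<forall>y\<in>data_item G ` matchable G h. (x, y) \<in> priority A h)"
  proof (rule linear_order_on_ex1_least)
    show "linear_order_on possible_items (priority A h)"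
      using A by (simp add: adaptive_priority_algorithm_def)
    show "finite (data_item G ` matchable G h)"
      using G by (simp add: matchable_def simple_graph_def)
    show "data_item G ` matchable G h \<noteq> {}" using ne by simp
    show "data_item G ` matchable G h \<subseteq> possible_items"
      using data_item_possible[OF G] by auto
  qed
  then have "next_item A G h \<in> data_item G ` matchable G h \<and>
      (\<forall>y\<in>data_item G ` matchable G h. (next_item A G h, y) \<in> priority A h)"
    unfolding next_item_def by (rule theI')
  then show "next_item A G h \<in> data_item G ` matchable G h"
    and "\<forall>y \<in> data_item G ` matchable G h. (next_item A G h, y) \<in> priority A h" by auto
qed

text \<open>An induction rule for the loop, with one case per kind of decision. Each round makes the
  node of the received item unmatchable, so the number of matchable nodes decreases and the loop
  terminates.\<close>

lemma run_invariant:
  assumes A: "adaptive_priority_algorithm A" and G: "simple_graph G"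
    and init: "P []"
    and match: "\<And>h u v. P h \<Longrightarrow> \<not> finished G h \<Longrightarrow> u \<in> matchable G h \<Longrightarrow>
        next_item A G h = data_item G u \<Longrightarrow> decide A h (data_item G u) = Match v \<Longrightarrow>
        v \<in> neighbors G u - unmatchable h \<Longrightarrow> P (h @ [(data_item G u, Match v)])"
    and isolate: "\<And>h u. P h \<Longrightarrow> \<not> finished G h \<Longrightarrow> u \<in> matchable G h \<Longrightarrow>
        next_item A G h = data_item G u \<Longrightarrow> decide A h (data_item G u) = Isolate \<Longrightarrow>
        P (h @ [(data_item G u, Isolate)])"
  shows "P (run A G)" "finished G (run A G)"
proof -
  have step: "P (next_history A G h) \<and> card (matchable G (next_history A G h)) < card (matchable G h)"
    if "P h" "\<not> finished G h" for h
  proof -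
    have "matchable G h \<noteq> {}" using that by (auto simp: finished_def)
    from next_item_least(1)[OF A G this]
    obtain u where u: "u \<in> matchable G h" "next_item A G h = data_item G u" by blast
    define D where "D = decide A h (data_item G u)"
    have nh: "next_history A G h = h @ [(data_item G u, D)]"
      by (simp add: next_history_def u D_def Let_def)
    have "u \<in> unmatchable (next_history A G h)" "unmatchable h \<subseteq> unmatchable (next_history A G h)"
      unfolding nh data_item_def
      by (cases D; auto simp: unmatchable_snoc_Match unmatchable_snoc_Isolate)+
    with u have "matchable G (next_history A G h) \<subset> matchable G h"
      by (auto simp: matchable_def)
    then have "card (matchable G (next_history A G h)) < card (matchable G h)"
      using G by (intro psubset_card_mono) (simp_all add: matchable_def simple_graph_def)
    moreover have "P (next_history A G h)"
    proof (cases D)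
      case (Match v)
      then have "v \<in> neighbors G u - unmatchable h"
        using A data_item_possible[OF G, of u]
        unfolding adaptive_priority_algorithm_def D_def data_item_def by blast
      with match that u Match show ?thesis by (simp add: nh D_def)
    next
      case Isolate
      with isolate that u show ?thesis by (simp add: nh D_def)
    qed
    ultimately show ?thesis by simp
  qed
  have "P (run A G) \<and> finished G (run A G)"
    unfolding run_def
    by (rule while_rule[where P=P and r="measure (\<lambda>h. card (matchable G h))"])
      (use init step in auto)
  then show "P (run A G)" "finished G (run A G)" by auto
qed

lemma matching_snoc:
  assumes G: "simple_graph G" and M: "matching G (edge_set es)" and v: "v \<in> neighbors G u"
    and disj: "u \<notin> \<Union> (edge_set es)" "v \<notin> \<Union> (edge_set es)"
  shows "matching G (edge_set (es @ [(u, v)]))"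
proof -
  have "edge_set (es @ [(u, v)]) = insert {u, v} (edge_set es)" by (simp add: edge_set_def)
  moreover have "{u, v} \<in> edges G" using v by (simp add: neighbors_def)
  moreover have "pairwise disjnt (insert {u, v} (edge_set es))"
    using M disj unfolding pairwise_insert matching_def disjnt_def by auto
  ultimately show ?thesis using M by (simp add: matching_def)
qed

text \<open>Decisions are irrevocable: whatever happens later, the first one is visible in the
  output. This is all the adversary needs to know about the run.\<close>

lemma run_first_decision:
  assumes A: "adaptive_priority_algorithm A" and G: "simple_graph G" and E: "edges G \<noteq> {}"
    and first: "next_item A G [] = data_item G u" "u \<in> verts G"
  shows "matching G (computed_matching A G)"
    and "(\<exists>v \<in> neighbors G u. decide A [] (data_item G u) = Match v \<and> {u, v} \<in> computed_matching A G) \<or>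
      decide A [] (data_item G u) = Isolate \<and> u \<notin> \<Union> (computed_matching A G)"
proof -
  define D where "D = decide A [] (data_item G u)"
  \<comment> \<open>The second conjunct keeps isolated nodes out of the matching forever; the third
    remembers the first decision once a round has taken place.\<close>
  define P where "P h \<longleftrightarrow> matching G (edge_set (matched_pairs h)) \<and>
    \<Union> (edge_set (matched_pairs h)) \<inter> isolated_nodes h = {} \<and>
    (h = [] \<or> (data_item G u, D) \<in> set h)" for h
  have unm: "unmatchable h = \<Union> (edge_set (matched_pairs h)) \<union> isolated_nodes h" for h :: "'a history"
    by (simp add: unmatchable_def matched_nodes_def)
  have "P (run A G)" and fin: "finished G (run A G)"
  proof (induction rule: run_invariant[OF A G, where P=P])
    case 1
    then show ?case by (simp add: P_def edge_set_def matching_def)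
  next
    case (2 h w v)
    have vw: "v \<notin> unmatchable h" "w \<notin> unmatchable h" "v \<in> neighbors G w"
      using 2 by (auto simp: matchable_def)
    have "edge_set (matched_pairs (h @ [(data_item G w, Match v)])) = insert {w, v} (edge_set (matched_pairs h))"
      by (simp add: data_item_def matched_pairs_append edge_set_def)
    moreover have "isolated_nodes (h @ [(data_item G w, Match v)]) = isolated_nodes h"
      by (auto simp: isolated_nodes_def)
    moreover have "matching G (edge_set (matched_pairs h @ [(w, v)]))"
      using 2 vw by (intro matching_snoc G) (auto simp: P_def unm)
    moreover have "h = [] \<Longrightarrow> data_item G w = data_item G u \<and> D = Match v"
      using 2 first by (simp add: D_def)
    ultimately show ?case
      using 2(1) vw by (auto simp: P_def unm edge_set_def)
  next
    case (3 h w)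
    have w: "w \<notin> unmatchable h" using 3 by (auto simp: matchable_def)
    have "matched_pairs (h @ [(data_item G w, Isolate)]) = matched_pairs h"
      by (simp add: data_item_def matched_pairs_append)
    moreover have "isolated_nodes (h @ [(data_item G w, Isolate)]) = insert w (isolated_nodes h)"
      by (auto simp: isolated_nodes_def data_item_def)
    moreover have "h = [] \<Longrightarrow> data_item G w = data_item G u \<and> D = Isolate"
      using 3 first by (simp add: D_def)
    ultimately show ?case
      using 3(1) w by (auto simp: P_def unm)
  qed
  then show "matching G (computed_matching A G)"
    by (simp add: P_def computed_matching_def)
  \<comment> \<open>As \<open>G\<close> has an edge, the loop is entered, which excludes the
    alternative \<open>h = []\<close> of the invariant.\<close>
  have "run A G \<noteq> []"
  proof
    assume "run A G = []"
    moreover obtain e where "e \<in> edges G" using E by blast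
    then obtain x y where xy: "y \<in> neighbors G x" by (rule edgeE[OF G])
    ultimately show False
      using fin neighbors_in_verts[OF G xy] xy
      by (auto simp: finished_def matchable_def unmatchable_Nil)
  qed
  with \<open>P (run A G)\<close> have mem: "(data_item G u, D) \<in> set (run A G)" by (simp add: P_def)
  show "(\<exists>v \<in> neighbors G u. decide A [] (data_item G u) = Match v \<and> {u, v} \<in> computed_matching A G) \<or>
      decide A [] (data_item G u) = Isolate \<and> u \<notin> \<Union> (computed_matching A G)"
  proof (cases D)
    case (Match v)
    have "(u, v) \<in> set (matched_pairs h)" if "((u, N), Match v) \<in> set h" for N h
      using that by (induction h rule: matched_pairs.induct) auto
    with mem Match have "{u, v} \<in> computed_matching A G"
      by (force simp: computed_matching_def edge_set_def data_item_def)
    moreover have "v \<in> neighbors G u"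
      using A data_item_possible[OF G, of u] Match
      unfolding adaptive_priority_algorithm_def D_def data_item_def by blast
    ultimately show ?thesis using Match D_def by auto
  next
    case Isolate
    with mem have "u \<in> isolated_nodes (run A G)" by (auto simp: isolated_nodes_def data_item_def)
    with \<open>P (run A G)\<close> Isolate show ?thesis
      by (auto simp: P_def computed_matching_def D_def)
  qed
qed

section \<open>Two triangles joined by a bridge, and the adversary\<close>

text \<open>The triangles are \<open>abc\<close> and \<open>def\<close>, the bridge is
  \<open>cd\<close>. For distinct nodes, \<open>c\<close> and \<open>d\<close> have degree 3 and the
  others degree 2.\<close>

definition barbell :: "'a \<Rightarrow> 'a \<Rightarrow> 'a \<Rightarrow> 'a \<Rightarrow> 'a \<Rightarrow> 'a \<Rightarrow> 'a graph" where
  "barbell a b c d e f = \<lparr>verts = {a, b, c, d, e, f},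
     edges = {{a, b}, {b, c}, {a, c}, {c, d}, {d, e}, {e, f}, {d, f}}\<rparr>"

context
  fixes a b c d e f :: 'a
  assumes distinct: "distinct [a, b, c, d, e, f]"
begin

lemma neighbors_barbell:
  "neighbors (barbell a b c d e f) x =
    (if x = a then {b, c} else if x = b then {a, c} else if x = c then {a, b, d}
     else if x = d then {c, e, f} else if x = e then {d, f} else if x = f then {d, e} else {})"
  using distinct by (auto simp: neighbors_def barbell_def doubleton_eq_iff)

lemma bounded_degree_graph_barbell: "bounded_degree_graph 3 (barbell a b c d e f)"
proof -
  have "simple_graph (barbell a b c d e f)"
  proof -
    have pair: "{x, y} \<in> {{u, v} |u v. u \<in> V \<and> v \<in> V \<and> u \<noteq> v}"
      if "x \<in> V" "y \<in> V" "x \<noteq> y" for x y :: 'a and V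
      using that by blast
    show ?thesis
      unfolding simple_graph_def barbell_def using distinct
      by (simp only: graph.simps insert_subset empty_subsetI, intro conjI pair) simp_all
  qed
  then show ?thesis
    using distinct
    by (simp add: bounded_degree_graph_def degree_def neighbors_barbell)
qed

lemma simple_graph_barbell: "simple_graph (barbell a b c d e f)"
  using bounded_degree_graph_barbell by (simp add: bounded_degree_graph_def)

lemma matching_number_barbell: "3 \<le> matching_number (barbell a b c d e f)"
proof -
  have "matching (barbell a b c d e f) {{a, b}, {c, d}, {e, f}}"
    using distinct by (auto simp: matching_def barbell_def pairwise_insert disjnt_def)
  moreover have "card {{a, b}, {c, d}, {e, f}} = 3"
    using distinct by (simp add: doubleton_eq_iff)
  ultimately show ?thesis using matching_number_ge[OF simple_graph_barbell] by metis
qed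

text \<open>A matching covers two nodes per edge, and five nodes have room for two edges
  only.\<close>

lemma card_matching_barbell_le:
  assumes M: "matching (barbell a b c d e f) M" and x: "x \<in> {a, b, c, d, e, f}" "x \<notin> \<Union> M"
  shows "card M \<le> 2"
proof -
  have "\<Union> M \<subseteq> {a, b, c, d, e, f} - {x}"
    using M x by (auto simp: matching_def barbell_def)
  then have "card (\<Union> M) \<le> card ({a, b, c, d, e, f} - {x})"
    by (intro card_mono) auto
  also have "\<dots> = 5" using x distinct by (auto simp: card_Diff_singleton)
  finally show ?thesis
    using card_Union_matching[OF simple_graph_barbell M] by simp
qed

text \<open>The edge \<open>ac\<close> uses up both neighbors of \<open>b\<close>, so
  \<open>b\<close> stays uncovered.\<close>

lemma card_matching_barbell_le_ac:
  assumes M: "matching (barbell a b c d e f) M" and ac: "{a, c} \<in> M"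
  shows "card M \<le> 2"
proof (rule card_matching_barbell_le[OF M])
  show "b \<notin> \<Union> M"
  proof
    assume "b \<in> \<Union> M"
    then obtain g where g: "g \<in> M" "b \<in> g" by blast
    with M have "g = {a, b} \<or> g = {b, c}"
      using distinct by (auto simp: matching_def barbell_def)
    moreover from this have "g \<noteq> {a, c}" using distinct by (auto simp: doubleton_eq_iff)
    then have "disjnt g {a, c}" using M g ac unfolding matching_def by (meson pairwiseD)
    ultimately show False by (auto simp: disjnt_def)
  qed
qed simp

text \<open>The condition on the decision is an equation of unordered pairs, so that it fits a
  received node \<open>a\<close> of degree 2 as well as a received node \<open>c\<close> of degree
  3. Isolating \<open>u\<close> is bad too, as it leaves \<open>u\<close> uncovered.\<close>

lemma computed_matching_barbell:
  assumes A: "adaptive_priority_algorithm A"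
    and first: "next_item A (barbell a b c d e f) [] = data_item (barbell a b c d e f) u"
      "u \<in> {a, b, c, d, e, f}"
    and decide: "\<And>v. decide A [] (data_item (barbell a b c d e f) u) = Match v \<Longrightarrow> {u, v} = {a, c}"
  shows "bounded_degree_graph 3 (barbell a b c d e f) \<and> 0 < matching_number (barbell a b c d e f) \<and>
    real (card (computed_matching A (barbell a b c d e f))) \<le>
      2 / 3 * real (matching_number (barbell a b c d e f))"
proof -
  let ?G = "barbell a b c d e f"
  have "edges ?G \<noteq> {}" "u \<in> verts ?G" using first by (simp_all add: barbell_def)
  note * = run_first_decision[OF A simple_graph_barbell this(1) first(1) this(2)]
  have "card (computed_matching A ?G) \<le> 2"
    using *(2) decide card_matching_barbell_le_ac[OF *(1)] card_matching_barbell_le[OF *(1) first(2)]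
    by auto
  with matching_number_barbell bounded_degree_graph_barbell show ?thesis by simp
qed

end

text \<open>The first item and the decision on it are the same on all barbells over \<open>U\<close>
  in which \<open>u\<close> has neighborhood \<open>N\<close>, so the adversary may fix the graph
  after seeing the decision. The assumption \<open>universe\<close> provides six
  identifiers.\<close>

lemma adversary:
  fixes A :: "'a priority_algorithm"
  assumes universe: "finite (UNIV :: 'a set) \<Longrightarrow> 6 \<le> card (UNIV :: 'a set)"
    and A: "adaptive_priority_algorithm A"
  shows "\<exists>G. bounded_degree_graph 3 G \<and> 0 < matching_number G \<and>
    real (card (computed_matching A G)) \<le> 2 / 3 * real (matching_number G)"
proof -
  obtain U :: "'a set" where U: "finite U" "card U = 6"
    using universe infinite_arbitrarily_large[of "UNIV :: 'a set" 6]
      obtain_subset_with_card_n[of 6 "UNIV :: 'a set"] by metis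
  \<comment> \<open>Every item of a barbell with node set \<open>U\<close> lies in \<open>X\<close>,
    wherever the nodes are placed.\<close>
  define X where "X = {(u, N). u \<in> U \<and> N \<subseteq> U - {u} \<and> (card N = 2 \<or> card N = 3)}"
  have "X \<subseteq> U \<times> Pow U" by (auto simp: X_def)
  then have finX: "finite X" using U by (meson finite_Pow_iff finite_SigmaI finite_subset)
  obtain u0 where u0: "u0 \<in> U" using U by fastforce
  then have "2 \<le> card (U - {u0})" using U by simp
  then obtain N0 where "N0 \<subseteq> U - {u0}" "card N0 = 2" by (rule obtain_subset_with_card_n)
  with u0 have "(u0, N0) \<in> X" by (simp add: X_def)
  then have neX: "X \<noteq> {}" by blast
  have "X \<subseteq> possible_items"
    using U by (auto simp: X_def possible_items_def intro: finite_subset)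
  then have "\<exists>!x. x \<in> X \<and> (\<forall>y\<in>X. (x, y) \<in> priority A [])"
    using A finX neX by (intro linear_order_on_ex1_least) (auto simp: adaptive_priority_algorithm_def)
  then obtain u N where uN: "(u, N) \<in> X" and least: "\<forall>y\<in>X. ((u, N), y) \<in> priority A []" by fast
  \<comment> \<open>The items of the graph form a subset of \<open>X\<close> that contains
    \<open>(u, N)\<close>, so the minimum of \<open>X\<close> is also theirs.\<close>
  have received: "next_item A (barbell a b c d e f) [] = data_item (barbell a b c d e f) u"
    if dist: "distinct [a, b, c, d, e, f]" and "{a, b, c, d, e, f} = U"
      and "neighbors (barbell a b c d e f) u = N" for a b c d e f
  proof (rule next_item_eqI[OF A simple_graph_barbell[OF dist]])
    have m: "matchable (barbell a b c d e f) [] = U"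
      using that by (simp add: matchable_def unmatchable_Nil barbell_def)
    show "data_item (barbell a b c d e f) u \<in> data_item (barbell a b c d e f) ` matchable (barbell a b c d e f) []"
      using uN m by (simp add: X_def)
    have "data_item (barbell a b c d e f) w \<in> X" if "w \<in> U" for w
      using that dist \<open>{a, b, c, d, e, f} = U\<close>[symmetric]
      by (simp add: X_def data_item_def neighbors_barbell[OF dist]) auto
    then show "\<forall>y\<in>data_item (barbell a b c d e f) ` matchable (barbell a b c d e f) [].
        (data_item (barbell a b c d e f) u, y) \<in> priority A []"
      using least that(3) by (auto simp: m data_item_def)
  qed
  have u: "u \<in> U" and N: "N \<subseteq> U" "u \<notin> N" "finite N" "card N = 2 \<or> card N = 3"
    using uN U by (auto simp: X_def intro: finite_subset)
  have "(u, N) \<in> possible_items" using N by (simp add: possible_items_def)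
  then have dec: "v \<in> N" if "decide A [] (u, N) = Match v" for v
    using A that unfolding adaptive_priority_algorithm_def by blast
  \<comment> \<open>If \<open>u\<close> is isolated, any neighbor serves as \<open>v\<close>; both
    decisions can then be treated alike.\<close>
  obtain v where v: "v \<in> N" "\<And>v'. decide A [] (u, N) = Match v' \<Longrightarrow> v' = v"
  proof (cases "decide A [] (u, N)")
    case (Match v)
    with dec that show ?thesis by simp
  next
    case Isolate
    moreover have "N \<noteq> {}" using N by auto
    ultimately show ?thesis using that by auto
  qed
  from N(4) show ?thesis
  proof
    \<comment> \<open>Here \<open>u\<close> plays the role of \<open>a\<close> and its partner
      \<open>v\<close> that of \<open>c\<close>; the three nodes outside form the other
      triangle.\<close>
    assume card: "card N = 2"
    then have "card (N - {v}) = 1" using v by simp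
    then obtain b where b: "N - {v} = {b}" by (auto simp: card_1_singleton_iff)
    have "card (U - insert u N) = 3"
      using U u N card by (simp add: card_Diff_subset)
    then obtain d e f where def: "U - insert u N = {d, e, f}" "d \<noteq> e" "d \<noteq> f" "e \<noteq> f"
      by (auto simp: card_3_iff)
    have Neq: "N = {b, v}" using b v by auto
    have dist: "distinct [u, b, v, d, e, f]" using b def Neq N by auto
    moreover have "{u, b, v, d, e, f} = U" using def Neq u N by auto
    moreover have nb: "neighbors (barbell u b v d e f) u = N"
      using Neq by (simp add: neighbors_barbell[OF dist])
    ultimately have "next_item A (barbell u b v d e f) [] = data_item (barbell u b v d e f) u"
      by (rule received)
    from computed_matching_barbell[OF dist A this] nb v(2) show ?thesis
      by (auto simp: data_item_def)
  next
    \<comment> \<open>Now \<open>u\<close> is the bridge end \<open>c\<close> and \<open>v\<close>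
      plays the role of \<open>a\<close>; either of the remaining neighbors may be the other end of
      the bridge.\<close>
    assume card: "card N = 3"
    then have "card (N - {v}) = 2" using v by simp
    then obtain b d where b: "N - {v} = {b, d}" "b \<noteq> d" by (auto simp: card_2_iff)
    have "card (U - insert u N) = 2"
      using U u N card by (simp add: card_Diff_subset)
    then obtain e f where ef: "U - insert u N = {e, f}" "e \<noteq> f" by (auto simp: card_2_iff)
    have Neq: "N = {v, b, d}" using b v by auto
    have dist: "distinct [v, b, u, d, e, f]" using b ef Neq N by auto
    moreover have "{v, b, u, d, e, f} = U" using ef Neq u N by auto
    moreover have nb: "neighbors (barbell v b u d e f) u = N"
      using Neq dist unfolding neighbors_barbell[OF dist] by auto
    ultimately have "next_item A (barbell v b u d e f) [] = data_item (barbell v b u d e f) u"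
      by (rule received)
    from computed_matching_barbell[OF dist A this] nb v(2) show ?thesis
      by (auto simp: data_item_def)
  qed
qed

section \<open>Min-degree greedy as a greedy adaptive priority algorithm\<close>

text \<open>This is the lexicographic order by \<open>key\<close> and then \<open>r\<close>:
  \<open>r\<close> breaks ties between equal keys. The key will be the current degree.\<close>

lemma linear_order_on_refine:
  fixes key :: "'a \<Rightarrow> 'b::linorder"
  assumes "linear_order_on A r"
  shows "linear_order_on A {(x, y). x \<in> A \<and> y \<in> A \<and> (key x < key y \<or> key x = key y \<and> (x, y) \<in> r)}"
    (is "linear_order_on A ?R")
proof -
  have r: "refl_on A r" "trans r" "antisym r" "total_on A r"
    using assms by (auto simp: order_on_defs)
  have "refl_on A ?R" using r(1) by (auto simp: refl_on_def)
  moreover have "trans ?R" using r(2) by (auto intro!: transI dest: transD)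
  moreover have "antisym ?R" using r(3) by (auto intro!: antisymI dest: antisymD)
  moreover have "total_on A ?R" using r(4) by (auto simp: total_on_def)
  ultimately show ?thesis by (auto simp: order_on_defs)
qed

text \<open>Items without a matchable neighbor come last: a node of current degree 0 must not be
  received before the run is finished.\<close>

definition current_degree :: "'a history \<Rightarrow> 'a item \<Rightarrow> enat" where
  "current_degree h x = (let k = card (snd x - unmatchable h) in if k = 0 then \<infinity> else enat k)"

text \<open>Hilbert choice settles what min-degree greedy leaves open: one fixed linear order breaks
  ties in degree, and some matchable neighbor is taken as partner.\<close>

definition min_degree_algorithm :: "'a priority_algorithm" where
  "min_degree_algorithm = \<lparr>
     priority = (\<lambda>h. {(x, y). x \<in> possible_items \<and> y \<in> possible_items \<and>
       (current_degree h x < current_degree h y \<or> current_degree h x = current_degree h y \<and>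
        (x, y) \<in> (SOME r. linear_order_on possible_items r))}),
     decide = (\<lambda>h x. if snd x - unmatchable h = {} then Isolate
       else Match (SOME v. v \<in> snd x - unmatchable h))\<rparr>"

lemma adaptive_min_degree_algorithm: "adaptive_priority_algorithm min_degree_algorithm"
proof -
  \<comment> \<open>The well-ordering theorem yields a tie-breaking order for any universe.\<close>
  have "\<exists>r :: 'a item rel. linear_order_on possible_items r"
    using well_order_on unfolding well_order_on_def by blast
  then have "linear_order_on possible_items (SOME r :: 'a item rel. linear_order_on possible_items r)"
    by (rule someI_ex)
  then have "linear_order_on possible_items (priority min_degree_algorithm h)" for h :: "'a history"
    unfolding min_degree_algorithm_def by (simp add: linear_order_on_refine)
  moreover have "v \<in> N - unmatchable h"
    if "decide min_degree_algorithm h (u, N) = Match v" for h and u v :: 'a and N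
  proof -
    have ne: "N - unmatchable h \<noteq> {}" and v: "v = (SOME v. v \<in> N - unmatchable h)"
      using that by (auto simp: min_degree_algorithm_def split: if_splits)
    show ?thesis unfolding v using ne by (rule some_in_eq[THEN iffD2])
  qed
  ultimately show ?thesis unfolding adaptive_priority_algorithm_def by blast
qed

lemma greedy_min_degree_algorithm: "greedy min_degree_algorithm"
  by (simp add: greedy_def min_degree_algorithm_def)

lemma neighbors_delete_unmatchable:
  "w \<in> matchable G h \<Longrightarrow> neighbors (delete_verts G (unmatchable h)) w = neighbors G w - unmatchable h"
  by (simp add: neighbors_delete_verts matchable_def)

text \<open>An unfinished run has a matchable node with finite key, so the least key is finite and
  \<open>u\<close> has a current neighbor. Among finite keys, the order is that of the degrees in
  the remaining graph.\<close>

lemma min_degree_algorithm_received: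
  assumes G: "simple_graph G" and unfinished: "\<not> finished G h"
    and u: "u \<in> matchable G h" "next_item min_degree_algorithm G h = data_item G u"
  defines "H \<equiv> delete_verts G (unmatchable h)"
  shows "neighbors H u \<noteq> {}" and "w \<in> verts H \<Longrightarrow> neighbors H w \<noteq> {} \<Longrightarrow> degree H u \<le> degree H w"
proof -
  have key: "current_degree h (data_item G w) = (if neighbors H w = {} then \<infinity> else enat (degree H w))"
    if "w \<in> matchable G h" for w
    using that finite_neighbors[OF G]
    by (simp add: current_degree_def data_item_def degree_def H_def neighbors_delete_unmatchable)
  have VH: "verts H = matchable G h" by (simp add: H_def delete_verts_def matchable_def)
  have "\<forall>w\<in>matchable G h. (data_item G u, data_item G w) \<in> priority min_degree_algorithm h"
    using next_item_least(2)[OF adaptive_min_degree_algorithm G, of h] u by auto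
  then have le: "current_degree h (data_item G u) \<le> current_degree h (data_item G w)"
    if "w \<in> matchable G h" for w
    using that by (auto simp: min_degree_algorithm_def)
  obtain x y where "x \<in> matchable G h" "y \<in> matchable G h" "y \<in> neighbors G x"
    using unfinished by (auto simp: finished_def)
  then have "x \<in> matchable G h" "neighbors H x \<noteq> {}"
    by (auto simp: H_def neighbors_delete_unmatchable) (auto simp: matchable_def)
  then show "neighbors H u \<noteq> {}" using le[of x] key u(1) by (auto split: if_splits)
  then show "degree H u \<le> degree H w" if "w \<in> verts H" "neighbors H w \<noteq> {}"
    using le[of w] key u(1) that VH by (auto split: if_splits)
qed

lemma implements_min_degree_algorithm: "implements_min_degree_greedy min_degree_algorithm"
  unfolding implements_min_degree_greedy_def
proof (intro allI impI)
  fix G :: "'a graph"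
  assume G: "simple_graph G"
  let ?A = "min_degree_algorithm :: 'a priority_algorithm"
  define H where "H h = delete_verts G (unmatchable h)" for h
  \<comment> \<open>A run grows at its end, whereas \<open>min_degree_greedy\<close> builds its list
    from the front. Quantifying over all continuations \<open>es\<close> on the remaining graph
    bridges the gap.\<close>
  define P where "P h \<longleftrightarrow>
    (\<forall>es. min_degree_greedy (H h) es \<longrightarrow> min_degree_greedy G (matched_pairs h @ es))" for h
  have "P (run ?A G)" and fin: "finished G (run ?A G)"
  proof (induction rule: run_invariant[OF adaptive_min_degree_algorithm G, where P=P])
    case 1
    show ?case by (simp add: P_def H_def unmatchable_Nil delete_verts_empty)
  next
    case (2 h u v)
    note received = min_degree_algorithm_received[OF G 2(2-4), folded H_def]
    have "v \<in> neighbors (H h) u" using 2 by (simp add: H_def neighbors_delete_unmatchable)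
    moreover have "u \<in> verts (H h)" using 2 by (simp add: H_def delete_verts_def matchable_def)
    moreover have "H (h @ [(data_item G u, Match v)]) = delete_verts (H h) {u, v}"
      by (simp add: H_def data_item_def unmatchable_snoc_Match delete_verts_Un)
    moreover have "matched_pairs (h @ [(data_item G u, Match v)]) = matched_pairs h @ [(u, v)]"
      by (simp add: data_item_def matched_pairs_append)
    ultimately show ?case
      using 2(1) received by (auto simp: P_def intro!: min_degree_greedy.pick)
  next
    case (3 h u)
    \<comment> \<open>This case is contradictory: the received node has a current neighbor, and the
      algorithm then matches it.\<close>
    have "neighbors (H h) u \<noteq> {}"
      using min_degree_algorithm_received(1)[OF G 3(2-4)] by (simp add: H_def)
    with 3 show ?case
      by (auto simp: H_def neighbors_delete_unmatchable min_degree_algorithm_def data_item_def split: if_splits)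
  qed
  \<comment> \<open>A finished run leaves no edges, so the empty list is a valid continuation
    \<open>es\<close>.\<close>
  moreover have "edges (H (run ?A G)) = {}"
  proof (rule ccontr)
    assume "edges (H (run ?A G)) \<noteq> {}"
    then obtain e where "e \<in> edges (H (run ?A G))" by blast
    moreover have SH: "simple_graph (H (run ?A G))" by (simp add: H_def simple_graph_delete_verts G)
    ultimately obtain x y where xy: "y \<in> neighbors (H (run ?A G)) x" using edgeE by metis
    with neighbors_in_verts[OF SH xy] fin show False
      by (auto simp: finished_def matchable_def H_def delete_verts_def neighbors_def)
  qed
  ultimately show "min_degree_greedy G (matched_pairs (run ?A G))"
    using min_degree_greedy.stop by (fastforce simp: P_def)
qed

section \<open>The ratio 2/3 and its optimality\<close>

lemma min_degree_greedy_two_thirds: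
  assumes bd: "bounded_degree_graph 3 G" and es: "min_degree_greedy G es"
  shows "matching G (edge_set es) \<and> 2 / 3 * real (matching_number G) \<le> real (card (edge_set es))"
proof -
  have G: "simple_graph G" using bd by (simp add: bounded_degree_graph_def)
  obtain M where "matching G M" "card M = matching_number G"
    using matching_number_attained[OF G] .
  with min_degree_greedy_approx[OF es bd] have "2 * matching_number G \<le> 3 * length es" by metis
  with min_degree_greedy_matching[OF es G] show ?thesis by simp
qed

lemma ratio_le_two_thirds:
  fixes A :: "'a priority_algorithm"
  assumes universe: "finite (UNIV :: 'a set) \<Longrightarrow> 6 \<le> card (UNIV :: 'a set)"
    and A: "adaptive_priority_algorithm A" "achieves_ratio 3 A \<rho>"
  shows "\<rho> \<le> 2 / 3"
proof -
  obtain G where G: "bounded_degree_graph 3 G" "0 < matching_number G"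
    "real (card (computed_matching A G)) \<le> 2 / 3 * real (matching_number G)"
    using adversary[OF universe A(1)] by blast
  then have "\<rho> * real (matching_number G) \<le> 2 / 3 * real (matching_number G)"
    using A(2) unfolding achieves_ratio_def by (meson order_trans)
  with G(2) show ?thesis by simp
qed

text \<open>The guarantee meets the upper bound that the adversary puts on every achievable ratio,
  and achieving 2/3 implies achieving anything smaller.\<close>

lemma implements_min_degree_greedy_optimal:
  fixes A :: "'a priority_algorithm"
  assumes universe: "finite (UNIV :: 'a set) \<Longrightarrow> 6 \<le> card (UNIV :: 'a set)"
    and A: "adaptive_priority_algorithm A" "implements_min_degree_greedy A"
  shows "achieves_ratio 3 A (2 / 3) \<and> optimal_priority_algorithm 3 A"
proof -
  have ratio: "achieves_ratio 3 A (2 / 3)"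
    unfolding achieves_ratio_def computed_matching_def
  proof (intro allI impI)
    fix G :: "'a graph"
    assume bd: "bounded_degree_graph 3 G"
    then have "min_degree_greedy G (matched_pairs (run A G))"
      using A(2) by (simp add: implements_min_degree_greedy_def bounded_degree_graph_def)
    with min_degree_greedy_two_thirds[OF bd]
    show "2 / 3 * real (matching_number G) \<le> real (card (edge_set (matched_pairs (run A G))))" by blast
  qed
  have "achieves_ratio 3 A \<rho>" if "adaptive_priority_algorithm B" "achieves_ratio 3 B \<rho>"
    for B :: "'a priority_algorithm" and \<rho>
  proof -
    have "\<rho> \<le> 2 / 3" using ratio_le_two_thirds[OF universe that] by simp
    then have "\<rho> * real n \<le> 2 / 3 * real n" for n by (intro mult_right_mono) auto
    with ratio show ?thesis unfolding achieves_ratio_def by (meson order_trans)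
  qed
  with ratio A(1) show ?thesis unfolding optimal_priority_algorithm_def by blast
qed

theorem theorem5:
  assumes universe: "finite (UNIV :: 'a set) \<Longrightarrow> 6 \<le> card (UNIV :: 'a set)"
  shows "(\<forall>A :: 'a priority_algorithm. adaptive_priority_algorithm A \<longrightarrow>
            (\<exists>G. bounded_degree_graph 3 G \<and> 0 < matching_number G \<and>
              real (card (computed_matching A G)) \<le> 2 / 3 * real (matching_number G))) \<and>
         (\<forall>(A :: 'a priority_algorithm) \<rho>.
            adaptive_priority_algorithm A \<and> achieves_ratio 3 A \<rho> \<longrightarrow> \<rho> \<le> 2 / 3) \<and>
         (\<forall>(G :: 'a graph) es. bounded_degree_graph 3 G \<and> min_degree_greedy G es \<longrightarrow>
            matching G (edge_set es) \<and>
            2 / 3 * real (matching_number G) \<le> real (card (edge_set es))) \<and>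
         (\<exists>A :: 'a priority_algorithm.
            adaptive_priority_algorithm A \<and> greedy A \<and> implements_min_degree_greedy A) \<and>
         (\<forall>A :: 'a priority_algorithm.
            adaptive_priority_algorithm A \<and> implements_min_degree_greedy A \<longrightarrow>
            achieves_ratio 3 A (2 / 3) \<and> optimal_priority_algorithm 3 A)"
  using adversary[OF universe] ratio_le_two_thirds[OF universe] min_degree_greedy_two_thirds
    adaptive_min_degree_algorithm greedy_min_degree_algorithm implements_min_degree_algorithm
    implements_min_degree_greedy_optimal[OF universe]
  by (intro conjI) blast+

end
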